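(* Let $K$ be a compact Hausdorff space and let $X$ be a real Banach space. If $f\in C(K,X)$ is a non-zero right symmetric point of $C(K,X)$, then $M_f=K$, that is, $\|f(k)\|=\|f\|$ for every $k\in K$.
   Context: $C(K,X)$ denotes the real Banach space of continuous functions $f:K\to X$ with the supremum norm $\|f\|=\sup_{k\in K}\|f(k)\|$. For $f\in C(K,X)$, $M_f=\{k\in K:\|f(k)\|=\|f\|\}$. In a real normed space $Y$, $x\perp_{BJ}y$ (Birkhoff-James orthogonality) means $\|x+\lambda y\|\ge\|x\|$ for all $\lambda\in\mathbb{R}$. An element $x\in Y$ is a right symmetric point of $Y$ if for all $y\in Y$, $y\perp_{BJ}x$ implies $x\perp_{BJ}y$. *)

theory Defs
  imports "HOL-Analysis.Analysis"
begin

(* A compact Hausdorff space K is a type 'k::t2_space whose universe is compact.  For such K the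
   library type 'k \<Rightarrow>\<^sub>C 'x of bounded continuous functions is C(K,X): the next lemma shows that the
   boundedness requirement is vacuous, the one after it that the library norm is the sup norm. *)

lemma bcontfun_compact_iff:
  fixes g :: "'k::t2_space \<Rightarrow> 'x::real_normed_vector"
  assumes "compact (UNIV :: 'k set)"
  shows "g \<in> bcontfun \<longleftrightarrow> continuous_on UNIV g"
  using assms compact_continuous_image compact_imp_bounded unfolding bcontfun_def by blast

lemma norm_bcontfun_eq_SUP:
  fixes f :: "'k::topological_space \<Rightarrow>\<^sub>C 'x::real_normed_vector"
  shows "norm f = (SUP k. norm (apply_bcontfun f k))"
  by (simp add: norm_bcontfun_def dist_bcontfun.rep_eq)

definition norm_attainment_set ::
    "('k::topological_space \<Rightarrow>\<^sub>C 'x::real_normed_vector) \<Rightarrow> 'k set" where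
  "norm_attainment_set f = {k. norm (apply_bcontfun f k) = norm f}"

definition BJ_orthogonal :: "'y::real_normed_vector \<Rightarrow> 'y \<Rightarrow> bool" where
  "BJ_orthogonal x y \<longleftrightarrow> (\<forall>c::real. norm (x + c *\<^sub>R y) \<ge> norm x)"

definition right_symmetric_point :: "'y::real_normed_vector \<Rightarrow> bool" where
  "right_symmetric_point x \<longleftrightarrow> (\<forall>y. BJ_orthogonal y x \<longrightarrow> BJ_orthogonal x y)"

end

theory Submission
  imports Defs
begin

text \<open>
  Write \<open>N = \<parallel>f\<parallel>\<close> and suppose that some point \<open>a\<close> has \<open>r = \<parallel>f(a)\<parallel> < N\<close>. A function \<open>g\<close> with
  \<open>g \<perp> f\<close> but not \<open>f \<perp> g\<close> shows that \<open>f\<close> is not right symmetric. Choose a unit vector \<open>x\<close> with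
  \<open>f(a) = r x\<close> and let
    \<open>g(k) = (1 - \<alpha>(k)) N x - \<alpha>(k) f(k)\<close>,
  where the continuous weight \<open>\<alpha>\<close> depends on \<open>\<parallel>f(k)\<parallel>\<close> only: it is \<open>0\<close> when \<open>\<parallel>f(k)\<parallel> \<le> r\<close>, it is \<open>1\<close>
  when \<open>\<parallel>f(k)\<parallel> = N\<close>, and it is affine in between. As \<open>g(k)\<close> is a convex combination of two vectors of
  norm at most \<open>N\<close>, and \<open>g(a) = N x\<close>, we have \<open>\<parallel>g\<parallel> = N\<close>.

  At \<open>a\<close>, \<open>g\<close> has maximal norm and points in the direction of \<open>f\<close>; at a point \<open>b\<close> where \<open>f\<close> attains its
  norm, \<open>g\<close> has maximal norm and is opposite to \<open>f\<close>. So adding a positive multiple of \<open>f\<close> to \<open>g\<close> cannot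
  lower the norm because of \<open>a\<close>, and adding a negative multiple cannot because of \<open>b\<close>
  (\<open>BJ_orthogonal_if_aligned_and_opposed\<close>). On the other hand, \<open>f + c g\<close> is shorter than \<open>f\<close> for small
  \<open>c > 0\<close>: where \<open>\<parallel>f(k)\<parallel>\<close> is close to \<open>N\<close>, \<open>g\<close> is close to \<open>-f\<close>, and elsewhere \<open>\<parallel>f(k)\<parallel>\<close> leaves room
  for a small perturbation (\<open>perturbation_bound\<close> makes this quantitative and uniform).

  Working with a common direction \<open>x\<close> instead of \<open>f(a)\<close> itself covers \<open>f(a) = 0\<close> without a
  separate argument, and making \<open>\<alpha>\<close> a function of \<open>\<parallel>f(k)\<parallel>\<close> replaces an appeal to Urysohn's lemma.
\<close>

lemma bcontfun_attains_norm:
  fixes f :: "'k::t2_space \<Rightarrow>\<^sub>C 'x::real_normed_vector"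
  assumes "compact (UNIV :: 'k set)"
  obtains b where "norm (apply_bcontfun f b) = norm f"
proof -
  have "continuous_on UNIV (\<lambda>k. norm (apply_bcontfun f k))"
    by (intro continuous_intros continuous_on_apply_bcontfun)
  with assms obtain b where b: "\<And>k. norm (apply_bcontfun f k) \<le> norm (apply_bcontfun f b)"
    using continuous_attains_sup[of "UNIV :: 'k set"] by blast
  have "norm f = norm (apply_bcontfun f b)"
    using b by (intro antisym norm_bound norm_bounded)
  then show ?thesis using that by simp
qed

text \<open>
  A function is Birkhoff-James orthogonal to \<open>f\<close> as soon as it attains its norm both at a point where it
  is aligned with \<open>f\<close> and at a point where it is opposed to \<open>f\<close>: each point takes care of one sign
  of the scalar. Alignment at \<open>a\<close> is expressed through a unit vector \<open>x\<close>, which leaves \<open>f(a) = 0\<close> possible.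
\<close>
lemma BJ_orthogonal_if_aligned_and_opposed:
  fixes f g :: "'k::topological_space \<Rightarrow>\<^sub>C 'x::real_normed_vector"
  assumes x: "norm x = 1"
    and fa: "apply_bcontfun f a = r *\<^sub>R x" "r \<ge> 0"
    and ga: "apply_bcontfun g a = norm g *\<^sub>R x"
    and gb: "apply_bcontfun g b = - apply_bcontfun f b" "norm (apply_bcontfun g b) = norm g"
  shows "BJ_orthogonal g f"
  unfolding BJ_orthogonal_def
proof
  fix c :: real
  show "norm g \<le> norm (g + c *\<^sub>R f)"
  proof (cases "c \<ge> 0")
    case True
    have "apply_bcontfun (g + c *\<^sub>R f) a = (norm g + c * r) *\<^sub>R x"
      by (simp add: fa ga algebra_simps)
    then have "norm (apply_bcontfun (g + c *\<^sub>R f) a) = norm g + c * r"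
      using x True fa(2) by simp
    moreover have "c * r \<ge> 0" using True fa(2) by simp
    ultimately show ?thesis using norm_bounded[of "g + c *\<^sub>R f" a] by linarith
  next
    case False
    have "apply_bcontfun (g + c *\<^sub>R f) b = (1 - c) *\<^sub>R apply_bcontfun g b"
      by (simp add: gb(1) algebra_simps)
    then have "norm (apply_bcontfun (g + c *\<^sub>R f) b) = (1 - c) * norm g"
      using False gb(2) by simp
    moreover have "(1 - c) * norm g \<ge> 1 * norm g"
      using False by (intro mult_right_mono) auto
    ultimately show ?thesis using norm_bounded[of "g + c *\<^sub>R f" b] by linarith
  qed
qed

text \<open>
  Put \<open>d = N - r\<close>. For \<open>t = \<parallel>f(k)\<parallel>\<close> and \<open>s = \<alpha>(k)\<close>, the left-hand side bounds \<open>\<parallel>f(k) + c g(k)\<parallel>\<close>. Inserting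
  the assumed bound on \<open>t\<close> gives \<open>N (1 - c) - (1 - s) (d (1 - c s) - 2 c N)\<close>, and \<open>c\<close> is small enough
  that the last factor is non-negative.
\<close>
lemma perturbation_bound:
  fixes N d c s t :: real
  assumes s: "0 \<le> s" "s \<le> 1"
    and t: "t \<le> N - (1 - s) * d"
    and d: "0 \<le> d" and c: "0 \<le> c" "3 * c \<le> 1" "3 * (c * N) \<le> d"
  shows "(1 - c * s) * t + c * (1 - s) * N \<le> N * (1 - c)"
proof -
  have cs: "c * s \<le> c" using mult_left_mono[OF s(2) c(1)] by simp
  have "(1 - c * s) * t \<le> (1 - c * s) * (N - (1 - s) * d)"
    using t cs c by (intro mult_left_mono) auto
  moreover have "(2 / 3) * d \<le> (1 - c * s) * d"
    using cs c d by (intro mult_right_mono) auto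
  then have "0 \<le> (1 - s) * ((1 - c * s) * d - 2 * (c * N))"
    using s c by (intro mult_nonneg_nonneg) auto
  ultimately show ?thesis by (simp add: algebra_simps)
qed

theorem theorem2p7:
  fixes f :: "'k::t2_space \<Rightarrow>\<^sub>C 'x::banach"
  assumes "compact (UNIV :: 'k set)"
    and "f \<noteq> 0"
    and "right_symmetric_point f"
  shows "norm_attainment_set f = UNIV"
proof (rule ccontr)
  assume "norm_attainment_set f \<noteq> UNIV"
  then obtain a where "norm (apply_bcontfun f a) \<noteq> norm f"
    by (auto simp: norm_attainment_set_def)
  define N r where "N = norm f" and "r = norm (apply_bcontfun f a)"
  have fN: "norm (apply_bcontfun f k) \<le> N" for k
    by (simp add: N_def norm_bounded)
  have N: "N > 0" using assms(2) by (simp add: N_def)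
  have r: "0 \<le> r" "r < N"
    using \<open>norm (apply_bcontfun f a) \<noteq> norm f\<close> fN[of a] by (auto simp: r_def N_def)
  obtain b where b: "norm (apply_bcontfun f b) = N"
    using bcontfun_attains_norm[OF assms(1)] N_def by metis
  \<comment> \<open>If \<open>f(a) = 0\<close>, any direction serves; the value \<open>f(b) \<noteq> 0\<close> shows that \<open>X\<close> has one.\<close>
  obtain x where x: "norm x = 1" and fa: "apply_bcontfun f a = r *\<^sub>R x"
  proof (cases "r = 0")
    case True
    show ?thesis
      using True b N that[of "sgn (apply_bcontfun f b)"] by (auto simp: r_def norm_sgn)
  next
    case False
    then show ?thesis
      using that[of "sgn (apply_bcontfun f a)"] by (auto simp: r_def norm_sgn sgn_div_norm)
  qed

  define \<alpha> where "\<alpha> k = (max (norm (apply_bcontfun f k)) r - r) / (N - r)" for k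
  have \<alpha>: "0 \<le> \<alpha> k" "\<alpha> k \<le> 1" for k
    using r fN[of k] by (auto simp: \<alpha>_def divide_simps)
  have \<alpha>_a: "\<alpha> a = 0" and \<alpha>_b: "\<alpha> b = 1"
    using r b by (auto simp: \<alpha>_def r_def)
  have norm_f_le: "norm (apply_bcontfun f k) \<le> N - (1 - \<alpha> k) * (N - r)" for k
  proof -
    have "\<alpha> k * (N - r) = max (norm (apply_bcontfun f k)) r - r"
      using r by (simp add: \<alpha>_def)
    then show ?thesis by (simp add: left_diff_distrib)
  qed

  define g where
    "g = Bcontfun (\<lambda>k. ((1 - \<alpha> k) * N) *\<^sub>R x - \<alpha> k *\<^sub>R apply_bcontfun f k)"
  have "continuous_on UNIV (\<lambda>k. ((1 - \<alpha> k) * N) *\<^sub>R x - \<alpha> k *\<^sub>R apply_bcontfun f k)"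
    unfolding \<alpha>_def using r by (intro continuous_intros) auto
  then have g: "apply_bcontfun g k = ((1 - \<alpha> k) * N) *\<^sub>R x - \<alpha> k *\<^sub>R apply_bcontfun f k" for k
    unfolding g_def using bcontfun_compact_iff[OF assms(1)] by (subst Bcontfun_inverse) auto
  have "norm (apply_bcontfun g k) \<le> N" for k
  proof -
    have "norm (apply_bcontfun g k) \<le> (1 - \<alpha> k) * N + \<alpha> k * norm (apply_bcontfun f k)"
      unfolding g using \<alpha>[of k] N x by (intro norm_triangle_le_diff) auto
    also have "\<dots> \<le> (1 - \<alpha> k) * N + \<alpha> k * N"
      using \<alpha>[of k] fN by (intro add_left_mono mult_left_mono) auto
    finally show ?thesis by (simp add: algebra_simps)
  qed
  moreover have ga: "apply_bcontfun g a = N *\<^sub>R x" by (simp add: g \<alpha>_a)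
  then have "norm (apply_bcontfun g a) = N" using x N by simp
  ultimately have norm_g: "norm g = N"
    using norm_bounded[of g a] by (intro antisym norm_bound) auto

  have gb: "apply_bcontfun g b = - apply_bcontfun f b" by (simp add: g \<alpha>_b)
  have "BJ_orthogonal g f"
    by (rule BJ_orthogonal_if_aligned_and_opposed[OF x fa r(1), where b = b])
       (simp_all add: norm_g ga gb b)
  then have f_orth_g: "BJ_orthogonal f g"
    using assms(3) by (simp add: right_symmetric_point_def)

  define c where "c = (N - r) / (3 * N)"
  have c: "0 < c" "3 * c \<le> 1" "3 * (c * N) \<le> N - r"
    using N r by (auto simp: c_def)
  have "norm (apply_bcontfun (f + c *\<^sub>R g) k) \<le> N * (1 - c)" for k
  proof -
    have "c * \<alpha> k \<le> c" using mult_left_mono[OF \<alpha>(2)[of k], of c] c by simp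
    then have nonneg: "0 \<le> 1 - c * \<alpha> k" "0 \<le> c * (1 - \<alpha> k) * N"
      using c \<alpha>[of k] N by (linarith, simp)
    have "apply_bcontfun (f + c *\<^sub>R g) k
        = (1 - c * \<alpha> k) *\<^sub>R apply_bcontfun f k + (c * (1 - \<alpha> k) * N) *\<^sub>R x"
      by (simp add: g algebra_simps)
    also have "norm \<dots> \<le> norm ((1 - c * \<alpha> k) *\<^sub>R apply_bcontfun f k)
        + norm ((c * (1 - \<alpha> k) * N) *\<^sub>R x)"
      by (rule norm_triangle_ineq)
    also have "\<dots> = (1 - c * \<alpha> k) * norm (apply_bcontfun f k) + c * (1 - \<alpha> k) * N"
      using nonneg x by (simp only: norm_scaleR abs_of_nonneg mult_1_right)
    also have "\<dots> \<le> N * (1 - c)"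
      using perturbation_bound[OF \<alpha> norm_f_le] r c by simp
    finally show ?thesis .
  qed
  then have "norm (f + c *\<^sub>R g) \<le> N * (1 - c)" by (rule norm_bound)
  also have "\<dots> < N" using N c by simp
  finally show False
    using f_orth_g by (auto simp: BJ_orthogonal_def N_def not_less[symmetric])
qed

end
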